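(* Let $k\in\mathbb{N}$. For every finite coloring of $\mathbb{N}$ there are $x,y,z\in\mathbb{N}$ such that the set $$\{x+iy,\ xy,\ z\cdot x y^i : 0\le i\le k\}$$ is monochromatic.
   Context: $\mathbb{N}=\{1,2,3,\dots\}$. The index $i$ ranges over the integers $0,1,\dots,k$. A set is monochromatic if all its elements have the same color. *)

theory Defs imports Main
begin

text \<open>The paper's set of natural numbers is the positive integers, here \<open>{1..} :: nat set\<close>;
  colours of \<open>0\<close> play no role.\<close>

definition finite_coloring :: "'a set \<Rightarrow> ('a \<Rightarrow> 'c) \<Rightarrow> bool" where
  "finite_coloring S c \<longleftrightarrow> finite (c ` S)"

definition monochromatic :: "('a \<Rightarrow> 'c) \<Rightarrow> 'a set \<Rightarrow> bool" where
  "monochromatic c A \<longleftrightarrow> (\<forall>a\<in>A. \<forall>b\<in>A. c a = c b)"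

end

theory Submission imports Defs "HOL-Library.FuncSet"
begin

text \<open>
  Call a set additively or multiplicatively piecewise syndetic if it is so in \<open>(\<nat>, +)\<close> or
  \<open>({1..}, *)\<close>. Both notions are partition regular. Choose decreasing additively piecewise syndetic
  sets \<open>E\<^sub>0 \<supseteq> E\<^sub>1 \<supseteq> \<dots>\<close> such that the colour of \<open>g n\<close> is a constant \<open>\<chi> g\<close> for all
  \<open>n \<in> E\<^sub>j\<close> with \<open>g \<le> j\<close>. By van der Waerden's theorem one can moreover arrange that, for many \<open>h\<close>, a
  later set satisfies \<open>E\<^sub>J + l h \<subseteq> E\<^sub>g\<close> for \<open>l \<le> k\<close>. With \<open>x = g n\<close> and \<open>y = g h\<close> we have
  \<open>x + l y = g (n + l h)\<close>, so these elements have colour \<open>\<chi> g\<close>, and only the multiplicative condition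
  \<open>\<chi> g = \<chi> (g y) = \<chi> (z g y\<^sup>l)\<close> on the auxiliary colouring remains.

  For this one, the set of colours \<open>t\<close> of \<open>\<chi>\<close> whose class is multiplicatively piecewise syndetic is
  denoted by \<open>W\<close>. The remaining classes together are not piecewise syndetic, which leaves room to choose
  factors \<open>s\<^sub>0, s\<^sub>1, \<dots>\<close> all of whose nonempty finite products have colours in \<open>W\<close>. The Hales-Jewett theorem
  yields products \<open>y\<^sub>0, y\<^sub>1, \<dots>\<close> of disjoint sets of factors such that for every \<open>t \<in> W\<close> and every
  interval product \<open>y = y\<^bsub>j+1\<^esub> \<cdots> y\<^sub>i\<close> the class of \<open>t\<close> contains a progression \<open>w, w y, \<dots>, w y\<^sup>k\<close>.
  By the pigeonhole principle, \<open>y\<^sub>0 \<cdots> y\<^sub>j\<close> and \<open>y\<^sub>0 \<cdots> y\<^sub>i\<close> have the same colour for some \<open>j < i\<close>.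
\<close>

section \<open>The Hales-Jewett theorem\<close>

definition words :: "'a set \<Rightarrow> nat \<Rightarrow> 'a list set" where
  "words A N = {w. set w \<subseteq> A \<and> length w = N}"

text \<open>\<open>None\<close> is the variable letter.\<close>

definition variable_words :: "'a set \<Rightarrow> nat \<Rightarrow> 'a option list set" where
  "variable_words A N = {v. set v \<subseteq> insert None (Some ` A) \<and> None \<in> set v \<and> length v = N}"

definition fill :: "'a option list \<Rightarrow> 'a \<Rightarrow> 'a list" where
  "fill v a = map (case_option a (\<lambda>b. b)) v"

lemma finite_words: "finite A \<Longrightarrow> finite (words A N)"
  unfolding words_def by (rule finite_lists_length_eq)

lemma nth_fill:
  "q < length v \<Longrightarrow> fill v a ! q = (case v ! q of None \<Rightarrow> a | Some b \<Rightarrow> b)"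
  by (simp add: fill_def)

lemma fill_append: "fill (v @ w) a = fill v a @ fill w a"
  by (simp add: fill_def)

lemma fill_map_Some: "fill (map Some w) a = w"
  by (simp add: fill_def o_def)

lemma fill_in_words: "v \<in> variable_words A N \<Longrightarrow> a \<in> A \<Longrightarrow> fill v a \<in> words A N"
  by (auto simp: variable_words_def words_def fill_def split: option.splits)

lemma variable_words_mono: "A \<subseteq> B \<Longrightarrow> variable_words A N \<subseteq> variable_words B N"
  by (auto simp: variable_words_def)

lemma variable_words_append:
  assumes "v \<in> variable_words A M" "w \<in> variable_words A N"
  shows "v @ w \<in> variable_words A (M + N)"
  using assms by (auto simp: variable_words_def)

lemma variable_words_append_const:
  assumes "v \<in> variable_words A M" "w \<in> words A N"
  shows "v @ map Some w \<in> variable_words A (M + N)"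
  using assms by (auto simp: variable_words_def words_def)

lemma variable_words_const_append:
  assumes "w \<in> words A M" "v \<in> variable_words A N"
  shows "map Some w @ v \<in> variable_words A (M + N)"
  using assms by (auto simp: variable_words_def words_def)

lemma append_in_words: "v \<in> words A M \<Longrightarrow> w \<in> words A N \<Longrightarrow> v @ w \<in> words A (M + N)"
  by (auto simp: words_def)

definition line_regular :: "'a set \<Rightarrow> nat \<Rightarrow> nat \<Rightarrow> bool" where
  "line_regular A r N \<longleftrightarrow> (\<forall>\<chi>. \<chi> ` words A N \<subseteq> {..<r} \<longrightarrow>
     (\<exists>v\<in>variable_words A N. \<exists>t. \<forall>a\<in>A. \<chi> (fill v a) = t))"

text \<open>Numbering the colours by a bijection removes the restriction to numbers, so that
  functions can serve as colours later.\<close>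

lemma line_regular_colouring:
  fixes \<chi> :: "'a list \<Rightarrow> 'c"
  assumes "line_regular A (card K) N" "finite K" "\<chi> ` words A N \<subseteq> K" "A \<noteq> {}"
  obtains v t where "v \<in> variable_words A N" "\<And>a. a \<in> A \<Longrightarrow> \<chi> (fill v a) = t"
proof -
  obtain f where f: "bij_betw f K {..<card K}"
    using ex_bij_betw_finite_nat[OF \<open>finite K\<close>] by (auto simp: atLeast0LessThan)
  have "(f \<circ> \<chi>) ` words A N \<subseteq> {..<card K}"
    using assms(3) f by (auto simp: bij_betw_def)
  then obtain v t where v: "v \<in> variable_words A N" "\<forall>a\<in>A. (f \<circ> \<chi>) (fill v a) = t"
    using assms(1) unfolding line_regular_def by blast
  obtain a0 where "a0 \<in> A" using assms(4) by blast
  have "\<chi> (fill v a) = \<chi> (fill v a0)" if "a \<in> A" for a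
  proof -
    have "\<chi> (fill v a) \<in> K" "\<chi> (fill v a0) \<in> K"
      using assms(3) fill_in_words[OF v(1)] that \<open>a0 \<in> A\<close> by auto
    moreover have "f (\<chi> (fill v a)) = f (\<chi> (fill v a0))"
      using v(2) that \<open>a0 \<in> A\<close> by simp
    ultimately show ?thesis using f by (auto simp: bij_betw_def inj_on_def)
  qed
  then show thesis using that v(1) by blast
qed

text \<open>The lines meet at the extra letter \<open>b\<close>, in the common focus
  \<open>\<phi>\<close>. Indexing them by a set \<open>T\<close> of colours encodes that different
  lines have different colours.\<close>

definition focused :: "('a list \<Rightarrow> nat) \<Rightarrow> 'a set \<Rightarrow> 'a \<Rightarrow> nat \<Rightarrow> nat set \<Rightarrow> 'a list \<Rightarrow> bool" where
  "focused \<chi> A b N T \<phi> \<longleftrightarrow> \<phi> \<in> words (insert b A) N \<and>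
     (\<forall>t\<in>T. \<exists>v\<in>variable_words (insert b A) N. fill v b = \<phi> \<and> (\<forall>a\<in>A. \<chi> (fill v a) = t))"

text \<open>Induction on the number \<open>s\<close> of focused lines: a second block of letters,
  coloured by the entire colouring it induces on the first block, adds one more colour unless a line
  over the enlarged alphabet is already monochromatic.\<close>

lemma colour_focusing:
  assumes "finite A" "A \<noteq> {}" and reg: "\<And>r. \<exists>N. line_regular A r N"
  shows "\<exists>N. \<forall>\<chi>. \<chi> ` words (insert b A) N \<subseteq> {..<r} \<longrightarrow>
           (\<exists>v\<in>variable_words (insert b A) N. \<exists>t. \<forall>a\<in>insert b A. \<chi> (fill v a) = t) \<or>
           (\<exists>T \<phi>. finite T \<and> card T = s \<and> focused \<chi> A b N T \<phi>)"
proof (induction s)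
  case 0
  have "focused \<chi> A b 0 {} []" for \<chi>
    by (auto simp: focused_def words_def)
  then show ?case by (metis card.empty finite.emptyI)
next
  case (Suc s)
  let ?B = "insert b A"
  obtain N1 where N1: "\<And>\<chi>. \<chi> ` words ?B N1 \<subseteq> {..<r} \<Longrightarrow>
           (\<exists>v\<in>variable_words ?B N1. \<exists>t. \<forall>a\<in>?B. \<chi> (fill v a) = t) \<or>
           (\<exists>T \<phi>. finite T \<and> card T = s \<and> focused \<chi> A b N1 T \<phi>)"
    using Suc.IH by blast
  define K where "K = (words ?B N1 \<rightarrow>\<^sub>E {..<r})"
  have "finite K" unfolding K_def
    using assms(1) by (intro finite_PiE finite_words) auto
  obtain N2 where N2: "line_regular A (card K) N2" using reg by blast
  obtain a0 where a0: "a0 \<in> A" using assms(2) by blast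
  show ?case
  proof (intro exI[of _ "N1 + N2"] allI impI)
    fix \<chi> :: "'a list \<Rightarrow> nat"
    assume \<chi>: "\<chi> ` words ?B (N1 + N2) \<subseteq> {..<r}"
    define \<Psi> where "\<Psi> w = (\<lambda>u\<in>words ?B N1. \<chi> (u @ w))" for w
    have "\<Psi> w \<in> K" if "w \<in> words A N2" for w
    proof -
      have "w \<in> words ?B N2" using that by (auto simp: words_def)
      then show ?thesis using \<chi> append_in_words unfolding K_def \<Psi>_def by fastforce
    qed
    then have "\<Psi> ` words A N2 \<subseteq> K" by blast
    then obtain L \<Theta> where L: "L \<in> variable_words A N2" and \<Theta>: "\<And>a. a \<in> A \<Longrightarrow> \<Psi> (fill L a) = \<Theta>"
      using line_regular_colouring[OF N2 \<open>finite K\<close> _ assms(2)] by metis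
    have LB: "L \<in> variable_words ?B N2" using L variable_words_mono[of A ?B] by blast
    \<comment> \<open>The letter \<open>a0\<close> is arbitrary: along \<open>L\<close> all letters
      of \<open>A\<close>, though perhaps not \<open>b\<close>, induce the same colouring of the
      first block.\<close>
    define w0 where "w0 = fill L a0"
    have w0: "w0 \<in> words ?B N2" unfolding w0_def using LB a0 by (intro fill_in_words) auto
    have swap: "\<chi> (u @ fill L a) = \<chi> (u @ w0)" if "u \<in> words ?B N1" "a \<in> A" for u a
    proof -
      have "\<Psi> (fill L a) u = \<Psi> w0 u" using \<Theta> that a0 unfolding w0_def by metis
      then show ?thesis using that by (simp add: \<Psi>_def)
    qed
    define \<chi>' where "\<chi>' u = \<chi> (u @ w0)" for u
    have "\<chi>' ` words ?B N1 \<subseteq> {..<r}"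
      using \<chi> append_in_words[OF _ w0] unfolding \<chi>'_def by fastforce
    from N1[OF this]
    show "(\<exists>v\<in>variable_words ?B (N1 + N2). \<exists>t. \<forall>a\<in>?B. \<chi> (fill v a) = t) \<or>
           (\<exists>T \<phi>. finite T \<and> card T = Suc s \<and> focused \<chi> A b (N1 + N2) T \<phi>)"
    proof (elim disjE)
      assume "\<exists>v\<in>variable_words ?B N1. \<exists>t. \<forall>a\<in>?B. \<chi>' (fill v a) = t"
      then obtain v t where v: "v \<in> variable_words ?B N1" "\<And>a. a \<in> ?B \<Longrightarrow> \<chi>' (fill v a) = t"
        by blast
      have "\<forall>a\<in>?B. \<chi> (fill (v @ map Some w0) a) = t"
        using v(2) by (simp add: fill_append fill_map_Some \<chi>'_def)
      then show ?thesis using variable_words_append_const[OF v(1) w0] by blast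
    next
      assume "\<exists>T \<phi>. finite T \<and> card T = s \<and> focused \<chi>' A b N1 T \<phi>"
      then obtain T \<phi> where T: "finite T" "card T = s" "focused \<chi>' A b N1 T \<phi>" by blast
      have \<phi>: "\<phi> \<in> words ?B N1" using T(3) by (simp add: focused_def)
      show ?thesis
      proof (cases "\<chi>' \<phi> \<in> T")
        case True
        then obtain v where v: "v \<in> variable_words ?B N1" "fill v b = \<phi>"
            "\<And>a. a \<in> A \<Longrightarrow> \<chi>' (fill v a) = \<chi>' \<phi>"
          using T(3) unfolding focused_def by blast
        have "\<forall>a\<in>?B. \<chi> (fill (v @ map Some w0) a) = \<chi>' \<phi>"
          using v(2,3) by (auto simp: fill_append fill_map_Some \<chi>'_def)
        then show ?thesis using variable_words_append_const[OF v(1) w0] by blast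
      next
        case False
        \<comment> \<open>Each old line is continued by \<open>L\<close>; the constant word
          \<open>\<phi>\<close> followed by \<open>L\<close> is a line of the new colour
          \<open>\<chi>' \<phi>\<close>. All of them meet at
          \<open>\<phi> @ fill L b\<close>.\<close>
        have "\<exists>v\<in>variable_words ?B (N1 + N2). fill v b = \<phi> @ fill L b \<and> (\<forall>a\<in>A. \<chi> (fill v a) = t)"
          if "t \<in> insert (\<chi>' \<phi>) T" for t
        proof (cases "t \<in> T")
          case True
          then obtain v where v: "v \<in> variable_words ?B N1" "fill v b = \<phi>"
            "\<And>a. a \<in> A \<Longrightarrow> \<chi>' (fill v a) = t"
            using T(3) unfolding focused_def by blast
          have "\<forall>a\<in>A. \<chi> (fill (v @ L) a) = t"
            using v swap fill_in_words[OF v(1)] by (auto simp: fill_append \<chi>'_def)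
          then show ?thesis using variable_words_append[OF v(1) LB] v(2) fill_append by metis
        next
          case False
          then have "t = \<chi>' \<phi>" using that by blast
          then have "\<forall>a\<in>A. \<chi> (fill (map Some \<phi> @ L) a) = t"
            using swap \<phi> by (auto simp: fill_append fill_map_Some \<chi>'_def)
          then show ?thesis using variable_words_const_append[OF \<phi> LB]
            by (metis fill_append fill_map_Some)
        qed
        moreover have "\<phi> @ fill L b \<in> words ?B (N1 + N2)"
          using \<phi> LB by (intro append_in_words fill_in_words) auto
        ultimately have "focused \<chi> A b (N1 + N2) (insert (\<chi>' \<phi>) T) (\<phi> @ fill L b)"
          unfolding focused_def by blast
        moreover have "card (insert (\<chi>' \<phi>) T) = Suc s" using T False by simp
        ultimately show ?thesis using T(1) by blast
      qed
    qed
  qed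
qed

text \<open>Induction on the alphabet. With \<open>r\<close> colours there cannot be
  \<open>r + 1\<close> focused lines of different colours, so colour focusing leaves only the
  monochromatic line.\<close>

theorem hales_jewett:
  assumes "finite A" "A \<noteq> {}"
  shows "\<exists>N. line_regular A r N"
  using assms
proof (induction A arbitrary: r rule: finite_ne_induct)
  case (singleton a)
  have "[None] \<in> variable_words {a} 1" by (simp add: variable_words_def)
  then show ?case unfolding line_regular_def by blast
next
  case (insert b A)
  let ?B = "insert b A"
  obtain N where N: "\<And>\<chi>. \<chi> ` words ?B N \<subseteq> {..<r} \<Longrightarrow>
           (\<exists>v\<in>variable_words ?B N. \<exists>t. \<forall>a\<in>?B. \<chi> (fill v a) = t) \<or>
           (\<exists>T \<phi>. finite T \<and> card T = Suc r \<and> focused \<chi> A b N T \<phi>)"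
    using colour_focusing[OF insert.hyps(1,2) insert.IH] by metis
  have "\<not> (\<exists>T \<phi>. finite T \<and> card T = Suc r \<and> focused \<chi> A b N T \<phi>)"
    if \<chi>: "\<chi> ` words ?B N \<subseteq> {..<r}" for \<chi>
  proof
    assume "\<exists>T \<phi>. finite T \<and> card T = Suc r \<and> focused \<chi> A b N T \<phi>"
    then obtain T \<phi> where T: "card T = Suc r" "focused \<chi> A b N T \<phi>" by blast
    obtain a0 where a0: "a0 \<in> A" using insert.hyps(2) by blast
    have "T \<subseteq> {..<r}"
    proof
      fix t assume "t \<in> T"
      then obtain v where "v \<in> variable_words ?B N" "\<chi> (fill v a0) = t"
        using T(2) a0 unfolding focused_def by blast
      then show "t \<in> {..<r}" using \<chi> fill_in_words[of v ?B N a0] a0 by blast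
    qed
    then have "card T \<le> r" by (metis card_lessThan card_mono finite_lessThan)
    then show False using T(1) by simp
  qed
  with N show ?case unfolding line_regular_def by metis
qed

section \<open>Piecewise syndetic sets\<close>

locale semigroup_on =
  fixes S :: "'a set" and mult :: "'a \<Rightarrow> 'a \<Rightarrow> 'a" (infixl "\<cdot>" 70)
  assumes closed: "x \<in> S \<Longrightarrow> y \<in> S \<Longrightarrow> x \<cdot> y \<in> S"
    and assoc: "x \<in> S \<Longrightarrow> y \<in> S \<Longrightarrow> z \<in> S \<Longrightarrow> x \<cdot> y \<cdot> z = x \<cdot> (y \<cdot> z)"
    and nonempty: "S \<noteq> {}"
begin

text \<open>Equivalently, finitely many of the sets \<open>{u. u \<cdot> f \<in> A}\<close> cover a thick set.\<close>

definition piecewise_syndetic :: "'a set \<Rightarrow> bool" where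
  "piecewise_syndetic A \<longleftrightarrow> (\<exists>F. finite F \<and> F \<subseteq> S \<and>
     (\<forall>L. finite L \<longrightarrow> L \<subseteq> S \<longrightarrow> (\<exists>w\<in>S. \<forall>u\<in>L. \<exists>f\<in>F. w \<cdot> u \<cdot> f \<in> A)))"

lemma piecewise_syndeticI:
  assumes "finite F" "F \<subseteq> S"
    "\<And>L. finite L \<Longrightarrow> L \<subseteq> S \<Longrightarrow> \<exists>w\<in>S. \<forall>u\<in>L. \<exists>f\<in>F. w \<cdot> u \<cdot> f \<in> A"
  shows "piecewise_syndetic A"
  unfolding piecewise_syndetic_def using assms by (intro exI[of _ F]) simp

lemma not_piecewise_syndeticD:
  assumes "\<not> piecewise_syndetic A" "finite F" "F \<subseteq> S"
  shows "\<exists>L. finite L \<and> L \<subseteq> S \<and> (\<forall>w\<in>S. \<exists>u\<in>L. \<forall>f\<in>F. w \<cdot> u \<cdot> f \<notin> A)"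
proof (rule ccontr)
  assume *: "\<not> ?thesis"
  have "piecewise_syndetic A"
  proof (rule piecewise_syndeticI[OF assms(2,3)])
    fix L assume L: "finite L" "L \<subseteq> S"
    show "\<exists>w\<in>S. \<forall>u\<in>L. \<exists>f\<in>F. w \<cdot> u \<cdot> f \<in> A"
    proof (rule ccontr)
      assume "\<not> ?thesis"
      then have "\<forall>w\<in>S. \<exists>u\<in>L. \<forall>f\<in>F. w \<cdot> u \<cdot> f \<notin> A" by simp
      with L have "finite L \<and> L \<subseteq> S \<and> (\<forall>w\<in>S. \<exists>u\<in>L. \<forall>f\<in>F. w \<cdot> u \<cdot> f \<notin> A)" by simp
      with spec[OF *[unfolded not_ex], of L] show False by (rule notE)
    qed
  qed
  then show False using assms(1) by simp
qed

lemma not_piecewise_syndetic_empty: "\<not> piecewise_syndetic {}"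
proof
  assume "piecewise_syndetic {}"
  then obtain F where "\<forall>L. finite L \<longrightarrow> L \<subseteq> S \<longrightarrow> (\<exists>w\<in>S. \<forall>u\<in>L. \<exists>f\<in>F. w \<cdot> u \<cdot> f \<in> {})"
    unfolding piecewise_syndetic_def by blast
  moreover obtain s where "s \<in> S" using nonempty by blast
  ultimately show False by (metis empty_iff empty_subsetI finite.emptyI finite_insert insertI1 insert_subset)
qed

text \<open>Since \<open>A\<close> is small, a fixed finite \<open>L0\<close> contains for every
  \<open>w\<close> some \<open>v\<close> such that \<open>A\<close> misses all
  \<open>w \<cdot> v \<cdot> f\<close>. There only \<open>B\<close> can meet the union, so the
  products \<open>v \<cdot> f\<close> are the shifts for \<open>B\<close>.\<close>

lemma piecewise_syndetic_Un:
  assumes "piecewise_syndetic (A \<union> B)" "\<not> piecewise_syndetic A"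
  shows "piecewise_syndetic B"
proof -
  obtain F where F: "finite F" "F \<subseteq> S" and
    w: "\<forall>L. finite L \<longrightarrow> L \<subseteq> S \<longrightarrow> (\<exists>w\<in>S. \<forall>u\<in>L. \<exists>f\<in>F. w \<cdot> u \<cdot> f \<in> A \<union> B)"
    using assms(1) unfolding piecewise_syndetic_def by blast
  obtain L0 where L0: "finite L0" "L0 \<subseteq> S" and gap: "\<And>w. w \<in> S \<Longrightarrow> \<exists>u\<in>L0. \<forall>f\<in>F. w \<cdot> u \<cdot> f \<notin> A"
    using not_piecewise_syndeticD[OF assms(2) F] by (elim exE conjE) (rule that, auto)
  show ?thesis
  proof (rule piecewise_syndeticI)
    show "finite ((\<lambda>(u, f). u \<cdot> f) ` (L0 \<times> F))" using F L0 by simp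
    show "(\<lambda>(u, f). u \<cdot> f) ` (L0 \<times> F) \<subseteq> S" using F L0 closed by auto
    fix L assume L: "finite L" "L \<subseteq> S"
    have "finite ((\<lambda>(u, v). u \<cdot> v) ` (L \<times> L0))" "(\<lambda>(u, v). u \<cdot> v) ` (L \<times> L0) \<subseteq> S"
      using L L0 closed by auto
    from w[rule_format, OF this] obtain w where w: "w \<in> S"
      "\<And>u v. u \<in> L \<Longrightarrow> v \<in> L0 \<Longrightarrow> \<exists>f\<in>F. w \<cdot> (u \<cdot> v) \<cdot> f \<in> A \<union> B"
      by auto
    have "\<exists>f\<in>(\<lambda>(u, f). u \<cdot> f) ` (L0 \<times> F). w \<cdot> u \<cdot> f \<in> B" if u: "u \<in> L" for u
    proof -
      have uS: "u \<in> S" using u L by blast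
      obtain v where v: "v \<in> L0" "\<forall>f\<in>F. w \<cdot> u \<cdot> v \<cdot> f \<notin> A"
        using gap[of "w \<cdot> u"] w(1) uS closed by blast
      obtain f where f: "f \<in> F" "w \<cdot> (u \<cdot> v) \<cdot> f \<in> A \<union> B" using w(2) u v(1) by blast
      have "v \<in> S" "f \<in> S" using v f L0 F by auto
      then have eq: "w \<cdot> (u \<cdot> v) \<cdot> f = w \<cdot> u \<cdot> v \<cdot> f" "w \<cdot> u \<cdot> v \<cdot> f = w \<cdot> u \<cdot> (v \<cdot> f)"
        using w(1) uS closed assoc by simp_all
      then have "w \<cdot> u \<cdot> (v \<cdot> f) \<in> B" using f v(2) by auto
      then show ?thesis using v(1) f(1) by force
    qed
    then show "\<exists>w\<in>S. \<forall>u\<in>L. \<exists>f\<in>(\<lambda>(u, f). u \<cdot> f) ` (L0 \<times> F). w \<cdot> u \<cdot> f \<in> B"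
      using w(1) by blast
  qed
qed

lemma piecewise_syndetic_UN:
  assumes "finite I" "piecewise_syndetic (\<Union>i\<in>I. A i)"
  shows "\<exists>i\<in>I. piecewise_syndetic (A i)"
  using assms
proof (induction I rule: finite_induct)
  case empty
  then show ?case using not_piecewise_syndetic_empty by simp
next
  case (insert i I)
  then show ?case using piecewise_syndetic_Un[of "A i" "\<Union>i\<in>I. A i"] by auto
qed

end

section \<open>Addition and multiplication; progressions in additively piecewise syndetic
  sets\<close>

interpretation add: semigroup_on "UNIV :: nat set" "(+)"
  by unfold_locales auto

interpretation mult: semigroup_on "{1..} :: nat set" "(*)"
  by unfold_locales auto

lemma sum_list_fill:
  fixes v :: "nat option list"
  shows "sum_list (fill v a) = sum_list (fill v 0) + a * count_list v None"
  by (induction v) (auto simp: fill_def split: option.splits)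

lemma sum_list_words_le:
  fixes w :: "nat list"
  shows "w \<in> words {..L} N \<Longrightarrow> sum_list w \<le> N * L"
  by (induction w arbitrary: N) (force simp: words_def)+

text \<open>A word is coloured by a shift \<open>f\<close> that brings its sum into
  \<open>E\<close>. On a monochromatic line the shift is constant, and the sums form a progression
  whose difference is the number of variable positions. It is at most \<open>N\<close>, so partition
  regularity fixes one difference.\<close>

lemma piecewise_syndetic_add_progression:
  assumes "add.piecewise_syndetic E"
  shows "\<exists>d>0. add.piecewise_syndetic {n. \<forall>l\<le>L. n + l * d \<in> E}"
proof -
  obtain F where F: "finite F" and
    thick: "\<forall>L. finite L \<longrightarrow> (\<exists>w. \<forall>u\<in>L. \<exists>f\<in>F. w + u + f \<in> E)"
    using assms unfolding add.piecewise_syndetic_def by auto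
  obtain N where N: "line_regular {..L} (card F) N"
    using hales_jewett[of "{..L}"] by auto
  define D where "D d = {n. \<forall>l\<le>L. n + l * d \<in> E}" for d
  \<comment> \<open>Offsets of the first term of a progression: the fixed letters, of sum at most
    \<open>N * L\<close>, plus the common shift \<open>f\<close>.\<close>
  define G where "G = (\<lambda>(u, f). u + f) ` ({..N * L} \<times> F)"
  have "add.piecewise_syndetic (\<Union>d\<in>{1..N}. D d)"
  proof (rule add.piecewise_syndeticI[of G])
    show "finite G" using F by (simp add: G_def)
    fix M :: "nat set" assume M: "finite M"
    have "finite ((\<lambda>(v, w). v + sum_list w) ` (M \<times> words {..L} N))"
      using M finite_words by blast
    from thick[rule_format, OF this] obtain w where
      w: "\<And>v \<omega>. v \<in> M \<Longrightarrow> \<omega> \<in> words {..L} N \<Longrightarrow> \<exists>f\<in>F. w + (v + sum_list \<omega>) + f \<in> E"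
      by auto
    have "\<exists>g\<in>G. w + v + g \<in> (\<Union>d\<in>{1..N}. D d)" if v: "v \<in> M" for v
    proof -
      obtain \<chi> where \<chi>: "\<And>\<omega>. \<omega> \<in> words {..L} N \<Longrightarrow> \<chi> \<omega> \<in> F \<and> w + (v + sum_list \<omega>) + \<chi> \<omega> \<in> E"
        using w[OF v] by metis
      have "\<chi> ` words {..L} N \<subseteq> F" using \<chi> by blast
      then obtain p f where p: "p \<in> variable_words {..L} N" and f: "\<And>a. a \<in> {..L} \<Longrightarrow> \<chi> (fill p a) = f"
        using line_regular_colouring[OF N F] by (metis atMost_iff empty_iff le0)
      define d where "d = count_list p None"
      have "None \<in> set p" "length p = N" using p by (auto simp: variable_words_def)
      then have d: "d \<in> {1..N}"
        unfolding d_def using count_le_length[of p None] by (auto simp: Suc_le_eq count_list_0_iff intro!: Nat.gr0I)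
      have p0: "fill p 0 \<in> words {..L} N" using fill_in_words[OF p] by simp
      have fF: "f \<in> F" using f[of 0] \<chi>[OF p0] by simp
      have "sum_list (fill p 0) \<le> N * L" using p0 by (rule sum_list_words_le)
      then have g: "sum_list (fill p 0) + f \<in> G" using fF by (force simp: G_def)
      have "w + v + (sum_list (fill p 0) + f) + l * d \<in> E" if "l \<le> L" for l
        using \<chi>[OF fill_in_words[OF p], of l] f[of l] that sum_list_fill[of p l]
        by (simp add: d_def algebra_simps)
      then have "w + v + (sum_list (fill p 0) + f) \<in> D d" by (simp add: D_def)
      then show ?thesis using d g by blast
    qed
    then show "\<exists>w\<in>UNIV. \<forall>v\<in>M. \<exists>g\<in>G. w + v + g \<in> (\<Union>d\<in>{1..N}. D d)" by blast
  qed simp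
  then obtain d where "d \<in> {1..N}" "add.piecewise_syndetic (D d)"
    using add.piecewise_syndetic_UN by blast
  then show ?thesis by (auto simp: D_def intro!: exI[of _ d])
qed

section \<open>The multiplicative pattern\<close>

text \<open>In the application, \<open>R g\<close> consists of the \<open>h\<close> such that adding \<open>l * h\<close> with \<open>l \<le> k\<close>
  to \<open>n\<close> does not change the colour of \<open>g * n\<close>.\<close>

lemma multiplier_step:
  fixes \<chi> :: "nat \<Rightarrow> 'c" and R :: "nat \<Rightarrow> nat set"
  assumes small: "\<not> mult.piecewise_syndetic {n \<in> {1..}. \<chi> n \<notin> W}"
    and anti: "\<And>i j. i \<le> j \<Longrightarrow> R j \<subseteq> R i"
    and thick: "\<And>j M. \<exists>d\<ge>1. \<forall>f\<in>{1..M}. d * f \<in> R j"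
  shows "\<exists>s\<ge>1. (\<forall>u\<in>{1..P}. \<chi> (u * s) \<in> W) \<and>
           (\<forall>g\<in>{1..P}. \<forall>v\<in>{1..P}. \<exists>h\<in>R g. s * v = g * h)"
proof -
  have "finite {1..P}" "{1..P} \<subseteq> {1..}" by auto
  from mult.not_piecewise_syndeticD[OF small this] obtain L where L: "finite L" "L \<subseteq> {1..}"
    and gap: "\<forall>w\<in>{1..}. \<exists>u\<in>L. \<forall>f\<in>{1..P}. w * u * f \<notin> {n \<in> {1..}. \<chi> n \<notin> W}"
    by blast
  obtain H where H: "\<And>u. u \<in> L \<Longrightarrow> u \<le> H"
    using L(1) by (meson finite_nat_set_iff_bounded_le)
  \<comment> \<open>As \<open>u\<close> is chosen only after \<open>d\<close>, this \<open>d\<close>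
    must serve all \<open>q * u * v\<close> with \<open>q\<close> up to \<open>fact P\<close>,
    \<open>u\<close> up to \<open>H\<close> and \<open>v\<close> up to \<open>P\<close>.\<close>
  obtain d where d: "d \<ge> 1" "\<And>f. 1 \<le> f \<Longrightarrow> f \<le> fact P * H * P \<Longrightarrow> d * f \<in> R P"
    using thick[of "fact P * H * P" P] by auto
  have "fact P * d \<in> {1..}" using d(1) by simp
  then obtain u where u: "u \<in> L" "\<And>f. f \<in> {1..P} \<Longrightarrow> \<chi> (fact P * d * u * f) \<in> W"
    using gap d(1) L(2) by fastforce
  have "u \<ge> 1" using u(1) L(2) by auto
  \<comment> \<open>The factor \<open>fact P\<close> makes \<open>s\<close> divisible by every
    \<open>g\<close> up to \<open>P\<close>; the quotient of \<open>s * v\<close> by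
    \<open>g\<close> is a multiple of \<open>d\<close> in \<open>R P\<close>, hence in
    \<open>R g\<close>.\<close>
  define s where "s = fact P * d * u"
  have "\<exists>h\<in>R g. s * v = g * h" if g: "g \<in> {1..P}" and v: "v \<in> {1..P}" for g v
  proof -
    have "g dvd fact P" using g by (intro dvd_fact) auto
    then obtain q where q: "fact P = g * q" by blast
    then have "q \<ge> 1" "q \<le> fact P" using g fact_nonzero[of P, where 'a = nat]
      by (auto simp: Suc_le_eq intro!: Nat.gr0I)
    then have "q * u * v \<le> fact P * H * P" "1 \<le> q * u * v"
      using v \<open>u \<ge> 1\<close> H[OF u(1)] by (auto intro!: mult_le_mono simp: Suc_le_eq)
    then have "d * (q * u * v) \<in> R g" using d(2) anti[of g P] g by auto
    moreover have "s * v = g * (d * (q * u * v))" unfolding s_def q by simp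
    ultimately show ?thesis by blast
  qed
  moreover have "s \<ge> 1" using d(1) \<open>u \<ge> 1\<close> by (simp add: s_def Suc_le_eq)
  moreover have "\<forall>u\<in>{1..P}. \<chi> (u * s) \<in> W" using u(2) by (simp add: s_def mult.commute)
  ultimately show ?thesis by blast
qed

text \<open>\<open>multiplier_step\<close> is iterated with \<open>P = p e\<close>, a positive
  multiple of the product of all factors chosen so far. Each subproduct divides it and so lies
  within the bound.\<close>

lemma multiplier_sequence:
  fixes \<chi> :: "nat \<Rightarrow> 'c" and R :: "nat \<Rightarrow> nat set"
  assumes "\<not> mult.piecewise_syndetic {n \<in> {1..}. \<chi> n \<notin> W}"
    and "\<And>i j. i \<le> j \<Longrightarrow> R j \<subseteq> R i"
    and "\<And>j M. \<exists>d\<ge>1. \<forall>f\<in>{1..M}. d * f \<in> R j"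
  obtains s :: "nat \<Rightarrow> nat" where "\<And>e. s e \<ge> 1"
    and "\<And>X e. X \<subseteq> {..<e} \<Longrightarrow> \<chi> (prod s X * s e) \<in> W"
    and "\<And>X Y e. X \<subseteq> {..<e} \<Longrightarrow> Y \<subseteq> {..<e} \<Longrightarrow> \<exists>h\<in>R (prod s X). s e * prod s Y = prod s X * h"
proof -
  define Q where "Q P s \<longleftrightarrow> s \<ge> 1 \<and> (\<forall>u\<in>{1..P}. \<chi> (u * s) \<in> W) \<and>
           (\<forall>g\<in>{1..P}. \<forall>v\<in>{1..P}. \<exists>h\<in>R g. s * v = g * h)" for P s
  have "\<exists>p. \<forall>e. p e \<ge> (1::nat) \<and> (\<exists>s. Q (p e) s \<and> p (Suc e) = p e * s)"
  proof (rule dependent_nat_choice)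
    fix x e :: nat assume "1 \<le> x"
    obtain s where s: "Q x s" using multiplier_step[of \<chi> W R x, OF assms] unfolding Q_def by blast
    then have "1 \<le> x * s" using \<open>1 \<le> x\<close> by (simp add: Q_def Suc_le_eq)
    then show "\<exists>y. 1 \<le> y \<and> (\<exists>s. Q x s \<and> y = x * s)" using s by blast
  qed auto
  then obtain p where p: "\<And>e. p e \<ge> 1" "\<And>e. \<exists>s. Q (p e) s \<and> p (Suc e) = p e * s" by blast
  then obtain s where s: "\<And>e. Q (p e) (s e)" "\<And>e. p (Suc e) = p e * s e" by metis
  have pos: "s e \<ge> 1" for e using s(1)[of e] by (simp add: Q_def)
  have p_eq: "p e = p 0 * prod s {..<e}" for e
    by (induction e) (simp_all add: s(2) mult.assoc)
  have range: "prod s X \<in> {1..p e}" if "X \<subseteq> {..<e}" for X e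
  proof -
    have "prod s X dvd prod s {..<e}" using that by (intro prod_dvd_prod_subset) auto
    then have "prod s X dvd p e" unfolding p_eq[of e] by simp
    then have "prod s X \<le> p e" using p(1)[of e] by (intro dvd_imp_le) auto
    moreover have "prod s X \<ge> 1" using pos by (intro prod_ge_1) auto
    ultimately show ?thesis by simp
  qed
  show thesis
  proof (rule that[of s])
    fix X :: "nat set" and e assume "X \<subseteq> {..<e}"
    then show "\<chi> (prod s X * s e) \<in> W" using range s(1)[of e] unfolding Q_def by blast
  next
    fix X Y :: "nat set" and e assume "X \<subseteq> {..<e}" "Y \<subseteq> {..<e}"
    then show "\<exists>h\<in>R (prod s X). s e * prod s Y = prod s X * h"
      using range s(1)[of e] unfolding Q_def by blast
  qed (rule pos)
qed

text \<open>As exponents of the variables \<open>y\<^sub>p\<close>, this letter encodes \<open>(y\<^bsub>j+1\<^esub> \<cdots> y\<^sub>i) ^ l\<close>; letter \<open>q\<close> of a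
  word carries the exponents of the factors with indices in \<open>{q * m..<(q + 1) * m}\<close>.\<close>

definition interval_letter :: "nat \<times> nat \<times> nat \<Rightarrow> nat \<Rightarrow> nat" where
  "interval_letter = (\<lambda>(j, i, l) p. if j < p \<and> p \<le> i then l else 0)"

text \<open>The fixed letters contribute a factor free of \<open>l\<close>, so the words of a line
  become a geometric progression with ratio \<open>prod s Y\<close>.\<close>

lemma prod_fill_interval_letter:
  fixes s :: "nat \<Rightarrow> nat" and m i j l :: nat
  assumes "length v = N"
  defines "Y \<equiv> {e \<in> {..<N * m}. v ! (e div m) = None \<and> j < e mod m \<and> e mod m \<le> i}"
  shows "(\<Prod>e<N * m. s e ^ (fill v (interval_letter (j, i, l)) ! (e div m)) (e mod m)) =
         (\<Prod>e<N * m. case v ! (e div m) of None \<Rightarrow> 1 | Some b \<Rightarrow> s e ^ b (e mod m)) * prod s Y ^ l"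
    (is "?lhs = prod ?C _ * _")
proof -
  have "?lhs = (\<Prod>e<N * m. ?C e * (if e \<in> Y then s e ^ l else 1))"
  proof (rule prod.cong[OF refl])
    fix e assume e: "e \<in> {..<N * m}"
    then have "e div m < N" by (simp add: less_mult_imp_div_less)
    then show "s e ^ (fill v (interval_letter (j, i, l)) ! (e div m)) (e mod m) =
               ?C e * (if e \<in> Y then s e ^ l else 1)"
      using e assms(1) by (auto simp: nth_fill Y_def interval_letter_def split: option.splits)
  qed
  also have "\<dots> = prod ?C {..<N * m} * (\<Prod>e\<in>{..<N * m} \<inter> Y. s e ^ l)"
    by (simp add: prod.distrib prod.inter_restrict)
  also have "{..<N * m} \<inter> Y = Y" by (auto simp: Y_def)
  finally show ?thesis by (simp add: prod_power_distrib)
qed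

lemma multiplicative_pattern:
  fixes \<chi> :: "nat \<Rightarrow> 'c" and R :: "nat \<Rightarrow> nat set"
  assumes fin: "finite (\<chi> ` {1..})"
    and anti: "\<And>i j. i \<le> j \<Longrightarrow> R j \<subseteq> R i"
    and thick: "\<And>j M. \<exists>d\<ge>1. \<forall>f\<in>{1..M}. d * f \<in> R j"
  shows "\<exists>g\<ge>1. \<exists>h\<in>R g. \<exists>z\<ge>1. \<chi> (g * (g * h)) = \<chi> g \<and> (\<forall>l\<le>k. \<chi> (z * (g * (g * h) ^ l)) = \<chi> g)"
proof -
  define colour_class where "colour_class t = {n \<in> {1..}. \<chi> n = t}" for t
  define W where "W = {t \<in> \<chi> ` {1..}. mult.piecewise_syndetic (colour_class t)}"
  have "finite W" using fin by (simp add: W_def)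
  have "{n \<in> {1..}. \<chi> n \<notin> W} = (\<Union>t\<in>\<chi> ` {1..} - W. colour_class t)" by (auto simp: colour_class_def)
  moreover have "\<not> mult.piecewise_syndetic (\<Union>t\<in>\<chi> ` {1..} - W. colour_class t)"
    using mult.piecewise_syndetic_UN[of "\<chi> ` {1..} - W" colour_class] fin by (auto simp: W_def)
  ultimately have small: "\<not> mult.piecewise_syndetic {n \<in> {1..}. \<chi> n \<notin> W}" by simp
  obtain s :: "nat \<Rightarrow> nat" where pos: "\<And>e. s e \<ge> 1"
    and in_W: "\<And>X e. X \<subseteq> {..<e} \<Longrightarrow> \<chi> (prod s X * s e) \<in> W"
    and div_R: "\<And>X Y e. X \<subseteq> {..<e} \<Longrightarrow> Y \<subseteq> {..<e} \<Longrightarrow> \<exists>h\<in>R (prod s X). s e * prod s Y = prod s X * h"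
    using multiplier_sequence[of \<chi> W R, OF small anti thick] by blast
  have prod_pos: "prod s X \<ge> 1" for X using pos by (intro prod_ge_1) auto
  have "\<forall>t\<in>W. \<exists>F. finite F \<and> F \<subseteq> {1..} \<and>
     (\<forall>L. finite L \<longrightarrow> L \<subseteq> {1..} \<longrightarrow> (\<exists>w\<in>{1..}. \<forall>u\<in>L. \<exists>f\<in>F. w * u * f \<in> colour_class t))"
    unfolding mult.piecewise_syndetic_def[symmetric] by (simp add: W_def)
  from bchoice[OF this] obtain F where F: "\<forall>t\<in>W. finite (F t) \<and> F t \<subseteq> {1..} \<and>
     (\<forall>L. finite L \<longrightarrow> L \<subseteq> {1..} \<longrightarrow> (\<exists>w\<in>{1..}. \<forall>u\<in>L. \<exists>f\<in>F t. w * u * f \<in> colour_class t))" ..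
  define m where "m = Suc (card W)"
  define A where "A = interval_letter ` ({..<m} \<times> {..<m} \<times> {..k})"
  have A: "finite A" "A \<noteq> {}" by (auto simp: A_def m_def)
  \<comment> \<open>The relevant colour \<open>t\<close> is known only after the line is found, so a
    word is coloured by one multiplier from \<open>F t\<close> for every \<open>t\<close> in
    \<open>W\<close> at once.\<close>
  define K where "K = PiE W F"
  have "finite K" unfolding K_def using \<open>finite W\<close> F by (intro finite_PiE) auto
  obtain N where N: "line_regular A (card K) N" using hales_jewett[OF A] by blast
  \<comment> \<open>The full product is put in front because the later \<open>g\<close> divides it;
    this supplies the factor \<open>g\<close> in \<open>z * (g * y ^ l)\<close>.\<close>
  define G where "G = prod s {..<N * m}"
  define val where "val \<omega> = G * (\<Prod>e<N * m. s e ^ (\<omega> ! (e div m)) (e mod m))" for \<omega> :: "(nat \<Rightarrow> nat) list"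
  have val: "finite (val ` words A N)" "val ` words A N \<subseteq> {1..}"
    using finite_words[OF A(1)] pos by (auto simp: val_def G_def Suc_le_eq intro!: prod_pos)
  have "\<forall>t\<in>W. \<exists>w\<in>{1..}. \<forall>u\<in>val ` words A N. \<exists>f\<in>F t. w * u * f \<in> colour_class t"
    using F[THEN bspec, THEN conjunct2, THEN conjunct2, rule_format, OF _ val] ..
  then obtain w where w: "\<And>t. t \<in> W \<Longrightarrow> w t \<ge> 1"
    "\<And>t \<omega>. t \<in> W \<Longrightarrow> \<omega> \<in> words A N \<Longrightarrow> \<exists>f\<in>F t. w t * val \<omega> * f \<in> colour_class t"
    by (metis atLeast_iff imageI)
  define \<Phi> where "\<Phi> \<omega> = (\<lambda>t\<in>W. SOME f. f \<in> F t \<and> w t * val \<omega> * f \<in> colour_class t)" for \<omega>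
  have \<Phi>: "\<Phi> \<omega> t \<in> F t" "w t * val \<omega> * \<Phi> \<omega> t \<in> colour_class t" if "t \<in> W" "\<omega> \<in> words A N" for t \<omega>
    using someI_ex[of "\<lambda>f. f \<in> F t \<and> w t * val \<omega> * f \<in> colour_class t"] w(2)[OF that] that
    by (auto simp: \<Phi>_def)
  have "\<Phi> ` words A N \<subseteq> K"
    using \<Phi>(1) by (auto simp: K_def PiE_iff extensional_def) (simp add: \<Phi>_def)
  then obtain v \<phi> where v: "v \<in> variable_words A N" and \<phi>: "\<And>a. a \<in> A \<Longrightarrow> \<Phi> (fill v a) = \<phi>"
    using line_regular_colouring[OF N \<open>finite K\<close> _ A(2)] by metis
  have len: "length v = N" using v by (simp add: variable_words_def)
  define S where "S = {q. q < N \<and> v ! q = None}"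
  have "S \<noteq> {}" using v by (auto simp: S_def variable_words_def in_set_conv_nth)
  moreover have "finite S" by (simp add: S_def)
  ultimately have top_S: "Max S \<in> S" "\<And>q. q \<in> S \<Longrightarrow> q \<le> Max S" by auto
  \<comment> \<open>\<open>prod s (X i)\<close> is the product
    \<open>y\<^sub>0 \<cdots> y\<^sub>i\<close>, with the offsets up to \<open>i\<close> taken from
    every variable block.\<close>
  define X where "X i = {e \<in> {..<N * m}. v ! (e div m) = None \<and> e mod m \<le> i}" for i
  have finX: "finite (X i)" for i by (simp add: X_def)
  \<comment> \<open>The index \<open>e i\<close> is the largest element of \<open>X i\<close> and increases with \<open>i\<close>, so the factor \<open>s (e i)\<close>
    was chosen after all factors of \<open>prod s (X j)\<close> for \<open>j < i\<close>.\<close>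
  define e where "e i = Max S * m + i" for i
  have e_X: "e i \<in> X i" if "i < m" for i
  proof -
    have "e i < Suc (Max S) * m" using that by (simp add: e_def)
    also have "\<dots> \<le> N * m" using top_S(1) by (intro mult_le_mono) (auto simp: S_def)
    finally show ?thesis using that top_S(1) by (simp add: X_def e_def S_def)
  qed
  have X_e: "x \<le> e j" if "x \<in> X j" for x j
  proof -
    have "x div m \<in> S" using that by (simp add: X_def S_def less_mult_imp_div_less)
    then have "(x div m) * m + x mod m \<le> e j"
      using top_S(2) that unfolding e_def by (intro add_mono mult_le_mono) (auto simp: X_def)
    then show ?thesis by simp
  qed
  have X_W: "\<chi> (prod s (X i)) \<in> W" if "i < m" for i
  proof -
    have "X i - {e i} \<subseteq> {..<e i}" using X_e[of _ i] by (auto simp: le_less)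
    then have "\<chi> (prod s (X i - {e i}) * s (e i)) \<in> W" by (rule in_W)
    then show ?thesis using prod.remove[OF finX e_X[OF that], of s] by (simp add: mult.commute)
  qed
  have "\<not> inj_on (\<lambda>i. \<chi> (prod s (X i))) {..<m}"
  proof (rule pigeonhole)
    have "card ((\<lambda>i. \<chi> (prod s (X i))) ` {..<m}) \<le> card W"
      using X_W \<open>finite W\<close> by (intro card_mono) auto
    then show "card ((\<lambda>i. \<chi> (prod s (X i))) ` {..<m}) < card {..<m}" by (simp add: m_def)
  qed
  then obtain i j where ij: "j < i" "i < m" "\<chi> (prod s (X j)) = \<chi> (prod s (X i))"
    unfolding inj_on_def by (metis lessThan_iff nat_neq_iff)
  define Y where "Y = {e \<in> {..<N * m}. v ! (e div m) = None \<and> j < e mod m \<and> e mod m \<le> i}"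
  have finY: "finite Y" by (simp add: Y_def)
  define g y t where "g = prod s (X j)" and "y = prod s Y" and "t = \<chi> g"
  have "X i = X j \<union> Y" "X j \<inter> Y = {}" using ij(1) by (auto simp: X_def Y_def)
  then have gy: "prod s (X i) = g * y"
    using finX finY by (simp add: g_def y_def prod.union_disjoint)
  have "e i mod m = i" using ij(2) by (simp add: e_def)
  then have eY: "e i \<in> Y" using e_X[OF ij(2)] ij(1) by (auto simp: X_def Y_def)
  have "Y \<subseteq> X i" using \<open>X i = X j \<union> Y\<close> by blast
  then have "Y - {e i} \<subseteq> {..<e i}" using X_e[of _ i] by (force simp: le_less)
  moreover have "X j \<subseteq> {..<e i}"
  proof
    fix x assume "x \<in> X j"
    then have "x \<le> e j" by (rule X_e)
    also have "e j < e i" using ij(1) by (simp add: e_def)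
    finally show "x \<in> {..<e i}" by simp
  qed
  \<comment> \<open>Apart from the factor \<open>s (e i)\<close>, everything in \<open>y\<close> and
    \<open>g\<close> has a smaller index, so \<open>y\<close> is \<open>g\<close> times an element
    of \<open>R g\<close>.\<close>
  ultimately obtain h where h: "h \<in> R g" "s (e i) * prod s (Y - {e i}) = g * h"
    using div_R[of "X j" "e i" "Y - {e i}"] by (auto simp: g_def)
  then have y: "y = g * h" using prod.remove[OF finY eY, of s] by (simp add: y_def)
  have t: "t \<in> W" using X_W[of j] ij by (simp add: t_def g_def)
  have "g dvd G" unfolding g_def G_def by (intro prod_dvd_prod_subset) (auto simp: X_def)
  then obtain G' where G': "G = g * G'" by blast
  define C where "C = (\<Prod>e<N * m. case v ! (e div m) of None \<Rightarrow> 1 | Some b \<Rightarrow> s e ^ b (e mod m))"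
  define z where "z = w t * G' * C * \<phi> t"
  have pattern: "\<chi> (z * (g * y ^ l)) = t \<and> z * (g * y ^ l) \<ge> 1" if l: "l \<le> k" for l
  proof -
    let ?a = "interval_letter (j, i, l)"
    have a: "?a \<in> A" using l ij by (auto simp: A_def)
    have "w t * val (fill v ?a) * \<phi> t \<in> colour_class t"
      using \<Phi>(2)[OF t fill_in_words[OF v a]] \<phi>[OF a] by simp
    moreover have "w t * val (fill v ?a) * \<phi> t = z * (g * y ^ l)"
      unfolding val_def prod_fill_interval_letter[OF len] C_def[symmetric] Y_def[symmetric]
        y_def[symmetric] z_def G' by (simp only: mult_ac)
    ultimately show ?thesis by (simp add: colour_class_def)
  qed
  have "g \<ge> 1" by (simp only: g_def prod_pos)
  moreover have "z \<ge> 1" using pattern[of 0] by (auto simp: Suc_le_eq)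
  moreover have "\<chi> (g * (g * h)) = \<chi> g" using ij(3) gy y by (simp add: g_def)
  ultimately show ?thesis using h(1) pattern unfolding y t_def by blast
qed

section \<open>Sums and products\<close>

lemma piecewise_syndetic_add_constant:
  fixes c :: "nat \<Rightarrow> 'c"
  assumes "finite G" "G \<subseteq> {1..}" "finite (c ` {1..})" "add.piecewise_syndetic E" "E \<subseteq> {1..}"
  shows "\<exists>E'\<subseteq>E. add.piecewise_syndetic E' \<and> (\<forall>g\<in>G. \<exists>t. \<forall>n\<in>E'. c (g * n) = t)"
  using assms(1,2)
proof (induction G rule: finite_induct)
  case empty
  then show ?case using assms(4) by auto
next
  case (insert g G)
  then obtain E' where E': "E' \<subseteq> E" "add.piecewise_syndetic E'" "\<forall>g\<in>G. \<exists>t. \<forall>n\<in>E'. c (g * n) = t"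
    by auto
  have "c (g * n) \<in> c ` {1..}" if "n \<in> E'" for n
    using that E'(1) assms(5) insert.prems by (force simp: Suc_le_eq)
  then have "(\<Union>t\<in>c ` {1..}. {n \<in> E'. c (g * n) = t}) = E'" by auto
  then have "add.piecewise_syndetic (\<Union>t\<in>c ` {1..}. {n \<in> E'. c (g * n) = t})"
    using E'(2) by simp
  from add.piecewise_syndetic_UN[OF assms(3) this]
  obtain t where t: "add.piecewise_syndetic {n \<in> E'. c (g * n) = t}" by blast
  show ?case
    using E' t by (intro exI[of _ "{n \<in> E'. c (g * n) = t}"]) blast
qed

lemma piecewise_syndetic_add_atLeast: "add.piecewise_syndetic {1..}"
  by (rule add.piecewise_syndeticI[of "{1}"]) auto

text \<open>Each step passes to the starting points of progressions and then thins them out to fix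
  colours; both keep piecewise syndeticity. The length \<open>k * Suc j\<close> grows with
  \<open>j\<close> so that multiples of \<open>d\<close> can serve as differences too.\<close>

lemma nested_piecewise_syndetic_sets:
  fixes c :: "nat \<Rightarrow> 'c"
  assumes fin: "finite (c ` {1..})"
  obtains E :: "nat \<Rightarrow> nat set" where "\<And>j. E j \<noteq> {}" "\<And>j. E j \<subseteq> {1..}" "\<And>j. E (Suc j) \<subseteq> E j"
    and "\<And>j g. g \<in> {1..Suc j} \<Longrightarrow> \<exists>t. \<forall>n\<in>E (Suc j). c (g * n) = t"
    and "\<And>j. \<exists>d\<ge>1. \<forall>n\<in>E (Suc j). \<forall>l\<le>k * Suc j. n + l * d \<in> E j"
proof -
  define Q where "Q j E E' \<longleftrightarrow> E' \<subseteq> E \<and> (\<forall>g\<in>{1..Suc j}. \<exists>t. \<forall>n\<in>E'. c (g * n) = t) \<and>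
    (\<exists>d\<ge>1. \<forall>n\<in>E'. \<forall>l\<le>k * Suc j. n + l * d \<in> E)" for j and E E' :: "nat set"
  have "\<exists>E. \<forall>j. (add.piecewise_syndetic (E j) \<and> E j \<subseteq> {1..}) \<and> Q j (E j) (E (Suc j))"
  proof (rule dependent_nat_choice)
    show "\<exists>E. add.piecewise_syndetic E \<and> E \<subseteq> {1..}" using piecewise_syndetic_add_atLeast by blast
  next
    fix E j assume E: "add.piecewise_syndetic E \<and> E \<subseteq> {1..}"
    obtain d where d: "d > 0" "add.piecewise_syndetic {n. \<forall>l\<le>k * Suc j. n + l * d \<in> E}"
      using piecewise_syndetic_add_progression[of E "k * Suc j"] E by blast
    have sub: "{n. \<forall>l\<le>k * Suc j. n + l * d \<in> E} \<subseteq> E"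
    proof
      fix n assume "n \<in> {n. \<forall>l\<le>k * Suc j. n + l * d \<in> E}"
      then have "n + 0 * d \<in> E" by blast
      then show "n \<in> E" by simp
    qed
    have "finite {1..Suc j}" "{1..Suc j} \<subseteq> {1..}"
      "{n. \<forall>l\<le>k * Suc j. n + l * d \<in> E} \<subseteq> {1..}" using sub E by auto
    from piecewise_syndetic_add_constant[OF this(1,2) fin d(2) this(3)]
    obtain E' where E': "E' \<subseteq> {n. \<forall>l\<le>k * Suc j. n + l * d \<in> E}" "add.piecewise_syndetic E'"
      "\<forall>g\<in>{1..Suc j}. \<exists>t. \<forall>n\<in>E'. c (g * n) = t" by blast
    have "E' \<subseteq> E" using E'(1) sub by (rule subset_trans)
    moreover have "\<exists>d\<ge>1. \<forall>n\<in>E'. \<forall>l\<le>k * Suc j. n + l * d \<in> E"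
      using E'(1) d(1) by (intro exI[of _ d]) auto
    ultimately have "Q j E E'" using E'(3) unfolding Q_def by blast
    then show "\<exists>E'. (add.piecewise_syndetic E' \<and> E' \<subseteq> {1..}) \<and> Q j E E'"
      using E'(2) \<open>E' \<subseteq> E\<close> E by blast
  qed
  then obtain E where E: "\<And>j. add.piecewise_syndetic (E j)" "\<And>j. E j \<subseteq> {1..}"
    "\<And>j. Q j (E j) (E (Suc j))" by blast
  show thesis
  proof (rule that[of E])
    show "E j \<noteq> {}" for j using E(1)[of j] add.not_piecewise_syndetic_empty by metis
  qed (use E in \<open>auto simp: Q_def\<close>)
qed

theorem corollary1p5:
  fixes k :: nat and c :: "nat \<Rightarrow> 'c"
  assumes "k \<ge> 1"
    and "finite_coloring {1..} c"
  shows "\<exists>x\<in>{1..}. \<exists>y\<in>{1..}. \<exists>z\<in>{1..}.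
           monochromatic c
             ({x + i * y | i. i \<le> k} \<union> {x * y} \<union> {z * (x * y ^ i) | i. i \<le> k})"
proof -
  have fin: "finite (c ` {1..})" using assms(2) by (simp add: finite_coloring_def)
  obtain E :: "nat \<Rightarrow> nat set" where ne: "\<And>j. E j \<noteq> {}" and pos: "\<And>j. E j \<subseteq> {1..}"
    and dec: "\<And>j. E (Suc j) \<subseteq> E j"
    and const: "\<And>j g. g \<in> {1..Suc j} \<Longrightarrow> \<exists>t. \<forall>n\<in>E (Suc j). c (g * n) = t"
    and shift: "\<And>j. \<exists>d\<ge>1. \<forall>n\<in>E (Suc j). \<forall>l\<le>k * Suc j. n + l * d \<in> E j"
    using nested_piecewise_syndetic_sets[OF fin, of k] by blast
  have anti: "E j \<subseteq> E i" if "i \<le> j" for i j using lift_Suc_antimono_le[of E, OF dec that] .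
  \<comment> \<open>The choice of \<open>n\<close> is immaterial: for \<open>g \<ge> 1\<close> the
    colour of \<open>g * n\<close> is constant on \<open>E g\<close>.\<close>
  define \<chi> where "\<chi> g = c (g * (SOME n. n \<in> E g))" for g
  have \<chi>: "c (g * n) = \<chi> g" if "g \<ge> 1" "n \<in> E j" "g \<le> j" for g n j
  proof -
    have "n \<in> E g" using that anti by blast
    moreover have "(SOME n. n \<in> E g) \<in> E g" using ne[of g] some_in_eq by blast
    ultimately show ?thesis using const[of g "g - 1"] that(1) unfolding \<chi>_def by fastforce
  qed
  have "\<chi> ` {1..} \<subseteq> c ` {1..}"
  proof
    fix t assume "t \<in> \<chi> ` {1..}"
    then obtain g where g: "g \<ge> 1" "t = \<chi> g" by auto
    obtain n where n: "n \<in> E g" using ne by blast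
    then have "1 \<le> g * n" using g(1) pos[of g] by (auto simp: Suc_le_eq)
    then have "c (g * n) \<in> c ` {1..}" by (intro imageI) simp
    then show "t \<in> c ` {1..}" using \<chi>[OF g(1) n] g(2) by simp
  qed
  then have fin\<chi>: "finite (\<chi> ` {1..})" using fin by (rule finite_subset)
  define R where "R j = {h. h \<ge> 1 \<and> (\<exists>J. \<forall>n\<in>E J. \<forall>l\<le>k. n + l * h \<in> E j)}" for j
  have R_anti: "R j \<subseteq> R i" if "i \<le> j" for i j using anti[OF that] unfolding R_def by blast
  have R_thick: "\<exists>d\<ge>1. \<forall>f\<in>{1..M}. d * f \<in> R j" for j M
  proof -
    \<comment> \<open>At level \<open>j + M\<close> the progressions are long enough for all
      differences \<open>d * f\<close> with \<open>f \<le> M\<close>.\<close>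
    obtain d where d: "d \<ge> 1" "\<And>n l. n \<in> E (Suc (j + M)) \<Longrightarrow> l \<le> k * Suc (j + M) \<Longrightarrow> n + l * d \<in> E (j + M)"
      using shift[of "j + M"] by blast
    have "d * f \<in> R j" if f: "f \<in> {1..M}" for f
    proof -
      have "n + l * (d * f) \<in> E j" if "n \<in> E (Suc (j + M))" "l \<le> k" for n l
      proof -
        have "l * f \<le> k * Suc (j + M)" using that(2) f by (intro mult_le_mono) auto
        then have "n + (l * f) * d \<in> E (j + M)" using d(2)[OF that(1)] by blast
        then show ?thesis using anti[of j "j + M"] by (auto simp: ac_simps)
      qed
      then show ?thesis using d(1) f by (auto simp: R_def Suc_le_eq)
    qed
    then show ?thesis using d(1) by blast
  qed
  obtain g h z where g: "g \<ge> 1" and h: "h \<in> R g" and z: "z \<ge> 1"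
    and gy: "\<chi> (g * (g * h)) = \<chi> g" and zy: "\<And>l. l \<le> k \<Longrightarrow> \<chi> (z * (g * (g * h) ^ l)) = \<chi> g"
    using multiplicative_pattern[of \<chi> R k, OF fin\<chi> R_anti R_thick] by blast
  have "h \<ge> 1" using h by (simp add: R_def)
  define y where "y = g * h"
  have y: "y \<ge> 1" using g \<open>h \<ge> 1\<close> by (simp add: y_def Suc_le_eq)
  obtain J where J: "\<And>n l. n \<in> E J \<Longrightarrow> l \<le> k \<Longrightarrow> n + l * h \<in> E g" using h by (auto simp: R_def)
  \<comment> \<open>\<open>n\<close> has to lie in \<open>E J\<close> for the sums, and deep enough
    that the colours of its multiples by \<open>g * y\<close> and by all
    \<open>z * (g * y ^ l)\<close> are given by \<open>\<chi>\<close>.\<close>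
  define J' where "J' = Max ({J, g * y} \<union> (\<lambda>l. z * (g * y ^ l)) ` {..k})"
  have J': "J \<le> J'" "g * y \<le> J'" "\<And>l. l \<le> k \<Longrightarrow> z * (g * y ^ l) \<le> J'"
    unfolding J'_def by (intro Max_ge; (simp; fail | blast))+
  obtain n where n: "n \<in> E J'" using ne by blast
  have n1: "n \<ge> 1" using n pos by auto
  define x where "x = g * n"
  have "c (x + i * y) = \<chi> g" if "i \<le> k" for i
  proof -
    have "n \<in> E J" using n anti[OF J'(1)] by blast
    then have "c (g * (n + i * h)) = \<chi> g" using J that by (intro \<chi>[OF g, of _ g]) auto
    then show ?thesis by (simp add: x_def y_def algebra_simps)
  qed
  moreover have "c (x * y) = \<chi> g"
    using \<chi>[of "g * y" n J'] n J'(2) gy g y by (simp add: x_def y_def Suc_le_eq ac_simps)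
  moreover have "c (z * (x * y ^ i)) = \<chi> g" if "i \<le> k" for i
  proof -
    have "1 \<le> z * (g * y ^ i)" using z g y by (simp add: Suc_le_eq)
    from \<chi>[OF this n J'(3)[OF that]] show ?thesis
      using zy[OF that] by (simp add: x_def y_def ac_simps)
  qed
  ultimately have "monochromatic c
      ({x + i * y | i. i \<le> k} \<union> {x * y} \<union> {z * (x * y ^ i) | i. i \<le> k})"
    unfolding monochromatic_def by auto
  moreover have "x \<ge> 1" using g n1 by (simp add: x_def Suc_le_eq)
  ultimately show ?thesis using y z by (meson atLeast_iff)
qed

end
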